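(* Let $A$ be a non-degenerate idempotent algebra with a coproduct $\Delta:A\to M(A\otimes A)$, and assume that there is an idempotent $E\in M(A\otimes A)$ such that $E(A\otimes A)=\Delta(A)(A\otimes A)$ and $(A\otimes A)E=(A\otimes A)\Delta(A)$. Then there is a unique homomorphism $\Delta_1:M(A)\to M(A\otimes A)$ that extends $\Delta$ from $A$ to $M(A)$ and that satisfies $\Delta_1(1)=E$.
   Context: Algebras are associative over $\mathbb C$, not necessarily unital. Non-degenerate: $ab=0$ for all $b$ implies $a=0$, and $ba=0$ for all $b$ implies $a=0$. Idempotent: $A^2=A$ (every element is a sum of products). $M(A)$ is the multiplier algebra. Products of subspaces denote linear spans of products. A coproduct on $A$ is a homomorphism $\Delta:A\to M(A\otimes A)$ with $\Delta(a)(1\otimes b)\in A\otimes A$ and $(a\otimes1)\Delta(b)\in A\otimes A$ for all $a,b\in A$, and which is coassociative: $(a\otimes1\otimes1)(\Delta\otimes\iota)(\Delta(b)(1\otimes c))=(\iota\otimes\Delta)((a\otimes1)\Delta(b))(1\otimes1\otimes c)$ for all $a,b,c\in A$, where $\iota$ is the identity map. *)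

theory Defs
  imports Complex_Main "HOL-Library.Poly_Mapping"
begin

section \<open>Complex vector spaces and (not necessarily unital) complex algebras\<close>

class complex_vector = ab_group_add +
  fixes scaleC :: "complex \<Rightarrow> 'a \<Rightarrow> 'a"  (infixr \<open>*\<^sub>C\<close> 75)
  assumes scaleC_add_right: "c *\<^sub>C (x + y) = c *\<^sub>C x + c *\<^sub>C y"
    and scaleC_add_left: "(c + d) *\<^sub>C x = c *\<^sub>C x + d *\<^sub>C x"
    and scaleC_scaleC: "c *\<^sub>C (d *\<^sub>C x) = (c * d) *\<^sub>C x"
    and scaleC_one: "1 *\<^sub>C x = x"

class complex_algebra = complex_vector + ring +
  assumes mult_scaleC_left: "(c *\<^sub>C x) * y = c *\<^sub>C (x * y)"
    and mult_scaleC_right: "x * (c *\<^sub>C y) = c *\<^sub>C (x * y)"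

global_interpretation complex_vector: vector_space "scaleC :: complex \<Rightarrow> 'a \<Rightarrow> 'a::complex_vector"
  defines cspan = "module.span (scaleC :: complex \<Rightarrow> 'a \<Rightarrow> 'a::complex_vector)"
    and csubspace = "module.subspace (scaleC :: complex \<Rightarrow> 'a \<Rightarrow> 'a::complex_vector)"
  by unfold_locales
    (simp_all add: scaleC_add_right scaleC_add_left scaleC_scaleC scaleC_one)

abbreviation clinear :: "('a::complex_vector \<Rightarrow> 'b::complex_vector) \<Rightarrow> bool" where
  "clinear \<equiv> Vector_Spaces.linear scaleC scaleC"

definition cbilinear ::
    "('a::complex_vector \<Rightarrow> 'b::complex_vector \<Rightarrow> 'c::complex_vector) \<Rightarrow> bool" where
  "cbilinear f \<longleftrightarrow> (\<forall>x. clinear (f x)) \<and> (\<forall>y. clinear (\<lambda>x. f x y))"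

definition algebra_hom :: "('a::complex_algebra \<Rightarrow> 'b::complex_algebra) \<Rightarrow> bool" where
  "algebra_hom f \<longleftrightarrow> clinear f \<and> (\<forall>x y. f (x * y) = f x * f y)"

definition nondegenerate :: "'a::complex_algebra itself \<Rightarrow> bool" where
  "nondegenerate _ \<longleftrightarrow>
     (\<forall>a::'a. (\<forall>b. a * b = 0) \<longrightarrow> a = 0) \<and> (\<forall>a::'a. (\<forall>b. b * a = 0) \<longrightarrow> a = 0)"

definition product_span :: "'a::complex_algebra set \<Rightarrow> 'a set \<Rightarrow> 'a set"  (infixl \<open>\<odot>\<close> 70) where
  "S \<odot> T = cspan {s * t |s t. s \<in> S \<and> t \<in> T}"

definition idempotent_algebra :: "'a::complex_algebra itself \<Rightarrow> bool" where
  "idempotent_algebra _ \<longleftrightarrow> (UNIV :: 'a set) \<odot> UNIV = UNIV"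

lemma clinear_iff:
  "clinear f \<longleftrightarrow> (\<forall>x y. f (x + y) = f x + f y) \<and> (\<forall>c x. f (c *\<^sub>C x) = c *\<^sub>C f x)"
  by (simp add: Vector_Spaces.linear_iff complex_vector.vector_space_axioms)

lemma clinearI:
  "(\<And>x y. f (x + y) = f x + f y) \<Longrightarrow> (\<And>c x. f (c *\<^sub>C x) = c *\<^sub>C f x) \<Longrightarrow> clinear f"
  by (simp add: clinear_iff)

lemma clinear_add: "clinear f \<Longrightarrow> f (x + y) = f x + f y"
  and clinear_scaleC: "clinear f \<Longrightarrow> f (c *\<^sub>C x) = c *\<^sub>C f x"
  by (simp_all add: clinear_iff)

lemma clinear_zero: "clinear f \<Longrightarrow> f 0 = 0"
  by (metis add_cancel_left_right clinear_add)

lemma clinear_diff: "clinear f \<Longrightarrow> f (x - y) = f x - f y"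
  by (metis add_diff_cancel_right' clinear_add diff_add_cancel)

lemma clinear_compose: "clinear f \<Longrightarrow> clinear g \<Longrightarrow> clinear (\<lambda>x. f (g x))"
  by (simp add: clinear_iff)

lemma cbilinearI:
  assumes "\<And>x y z. f x (y + z) = f x y + f x z" "\<And>c x y. f x (c *\<^sub>C y) = c *\<^sub>C f x y"
    and "\<And>x y z. f (x + y) z = f x z + f y z" "\<And>c x y. f (c *\<^sub>C x) y = c *\<^sub>C f x y"
  shows "cbilinear f"
  using assms by (simp add: cbilinear_def clinear_iff)

lemma cbilinear_add_right: "cbilinear f \<Longrightarrow> f x (y + z) = f x y + f x z"
  and cbilinear_scaleC_right: "cbilinear f \<Longrightarrow> f x (c *\<^sub>C y) = c *\<^sub>C f x y"
  and cbilinear_add_left: "cbilinear f \<Longrightarrow> f (x + w) y = f x y + f w y"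
  and cbilinear_scaleC_left: "cbilinear f \<Longrightarrow> f (c *\<^sub>C x) y = c *\<^sub>C f x y"
  by (simp_all add: cbilinear_def clinear_iff)

lemmas cbilinear_simps =
  cbilinear_add_right cbilinear_scaleC_right cbilinear_add_left cbilinear_scaleC_left

section \<open>The algebraic tensor product\<close>

instantiation complex :: complex_algebra
begin
definition scaleC_complex :: "complex \<Rightarrow> complex \<Rightarrow> complex" where
  "scaleC_complex c x = c * x"
instance by standard (simp_all add: scaleC_complex_def algebra_simps)
end

instantiation poly_mapping :: (type, complex_vector) complex_vector
begin
lift_definition scaleC_poly_mapping :: "complex \<Rightarrow> ('a \<Rightarrow>\<^sub>0 'b) \<Rightarrow> 'a \<Rightarrow>\<^sub>0 'b"
  is "\<lambda>c f k. c *\<^sub>C f k"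
  by (erule rev_finite_subset) auto
instance
  by standard (transfer; simp add: scaleC_add_right scaleC_add_left scaleC_scaleC scaleC_one)+
end

lemma lookup_scaleC: "Poly_Mapping.lookup (c *\<^sub>C p) k = c *\<^sub>C Poly_Mapping.lookup p k"
  by transfer simp

(* The finitely supported functions \<open>('a \<times> 'b) \<Rightarrow>\<^sub>0 complex\<close> are the free vector space on
   the set of pairs; \<open>Poly_Mapping.single (a, b) 1\<close> is the basis vector of the pair (a, b). *)

definition tensor_relators :: "(('a::complex_vector \<times> 'b::complex_vector) \<Rightarrow>\<^sub>0 complex) set" where
  "tensor_relators =
     {Poly_Mapping.single (a + a', b) 1
        - (Poly_Mapping.single (a, b) 1 + Poly_Mapping.single (a', b) 1) |a a' b. True} \<union>
     {Poly_Mapping.single (a, b + b') 1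
        - (Poly_Mapping.single (a, b) 1 + Poly_Mapping.single (a, b') 1) |a b b'. True} \<union>
     {Poly_Mapping.single (c *\<^sub>C a, b) 1 - c *\<^sub>C Poly_Mapping.single (a, b) 1 |c a b. True} \<union>
     {Poly_Mapping.single (a, c *\<^sub>C b) 1 - c *\<^sub>C Poly_Mapping.single (a, b) 1 |c a b. True}"

definition tensor_rel ::
    "(('a::complex_vector \<times> 'b::complex_vector) \<Rightarrow>\<^sub>0 complex) \<Rightarrow> (('a \<times> 'b) \<Rightarrow>\<^sub>0 complex) \<Rightarrow> bool" where
  "tensor_rel p q \<longleftrightarrow> p - q \<in> cspan tensor_relators"

quotient_type (overloaded) ('a, 'b) tensor  (infixr \<open>\<otimes>\<close> 20)
  = "('a::complex_vector \<times> 'b::complex_vector) \<Rightarrow>\<^sub>0 complex" / tensor_rel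
proof (rule equivpI)
  show "reflp tensor_rel"
    by (simp add: reflp_def tensor_rel_def complex_vector.span_zero)
  show "symp tensor_rel"
    unfolding symp_def tensor_rel_def
    by (metis complex_vector.span_neg minus_diff_eq)
  show "transp tensor_rel"
    unfolding transp_def tensor_rel_def
    by (metis (no_types, lifting) complex_vector.span_add diff_add_cancel add_diff_eq)
qed

instantiation tensor :: (complex_vector, complex_vector) complex_vector
begin

lift_definition zero_tensor :: "'a \<otimes> 'b" is 0 .

lift_definition plus_tensor :: "'a \<otimes> 'b \<Rightarrow> 'a \<otimes> 'b \<Rightarrow> 'a \<otimes> 'b" is "(+)"
  unfolding tensor_rel_def by (metis complex_vector.span_add add_diff_add)

lift_definition uminus_tensor :: "'a \<otimes> 'b \<Rightarrow> 'a \<otimes> 'b" is uminus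
  unfolding tensor_rel_def by (metis complex_vector.span_neg minus_diff_minus)

lift_definition minus_tensor :: "'a \<otimes> 'b \<Rightarrow> 'a \<otimes> 'b \<Rightarrow> 'a \<otimes> 'b" is "(-)"
proof -
  fix p q r s :: "('a \<times> 'b) \<Rightarrow>\<^sub>0 complex"
  assume "tensor_rel p q" "tensor_rel r s"
  then show "tensor_rel (p - r) (q - s)"
    unfolding tensor_rel_def
    using complex_vector.span_diff[of "p - q" tensor_relators "r - s"]
    by (simp add: algebra_simps)
qed

lift_definition scaleC_tensor :: "complex \<Rightarrow> 'a \<otimes> 'b \<Rightarrow> 'a \<otimes> 'b" is scaleC
  unfolding tensor_rel_def
  by (metis complex_vector.span_scale complex_vector.scale_right_diff_distrib)

instance
proof
  fix x y z :: "'a \<otimes> 'b" and c d :: complex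
  have refl: "tensor_rel p p" for p :: "('a \<times> 'b) \<Rightarrow>\<^sub>0 complex"
    by (simp add: tensor_rel_def complex_vector.span_zero)
  show "x + y + z = x + (y + z)" by transfer (simp add: refl add.assoc)
  show "x + y = y + x" by transfer (simp add: refl add.commute)
  show "0 + x = x" by transfer (simp add: refl)
  show "- x + x = 0" by transfer (simp add: refl)
  show "x - y = x + - y" by transfer (simp add: refl)
  show "c *\<^sub>C (x + y) = c *\<^sub>C x + c *\<^sub>C y" by transfer (simp add: refl scaleC_add_right)
  show "(c + d) *\<^sub>C x = c *\<^sub>C x + d *\<^sub>C x" by transfer (simp add: refl scaleC_add_left)
  show "c *\<^sub>C (d *\<^sub>C x) = (c * d) *\<^sub>C x" by transfer (simp add: refl scaleC_scaleC)
  show "1 *\<^sub>C x = x" by transfer (simp add: refl scaleC_one)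
qed

end

lift_definition tensor :: "'a::complex_vector \<Rightarrow> 'b::complex_vector \<Rightarrow> 'a \<otimes> 'b"  (infixr \<open>\<otimes>\<^sub>t\<close> 72)
  is "\<lambda>a b. Poly_Mapping.single (a, b) 1" .

definition free_extend ::
    "('a \<Rightarrow> 'b \<Rightarrow> 'c::complex_vector) \<Rightarrow> (('a \<times> 'b) \<Rightarrow>\<^sub>0 complex) \<Rightarrow> 'c" where
  "free_extend f p = (\<Sum>k\<in>Poly_Mapping.keys p. Poly_Mapping.lookup p k *\<^sub>C f (fst k) (snd k))"

lemma free_extend_superset:
  assumes "finite K" "Poly_Mapping.keys p \<subseteq> K"
  shows "free_extend f p = (\<Sum>k\<in>K. Poly_Mapping.lookup p k *\<^sub>C f (fst k) (snd k))"
  unfolding free_extend_def using assms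
  by (intro sum.mono_neutral_left) (auto simp: in_keys_iff)

lemma clinear_free_extend: "clinear (free_extend f)"
proof (rule clinearI)
  fix p q :: "('a \<times> 'b) \<Rightarrow>\<^sub>0 complex" and c :: complex
  let ?K = "Poly_Mapping.keys p \<union> Poly_Mapping.keys q"
  have "Poly_Mapping.keys (p + q) \<subseteq> ?K" by (rule Poly_Mapping.keys_add)
  then show "free_extend f (p + q) = free_extend f p + free_extend f q"
    by (simp add: free_extend_superset[of ?K] lookup_add scaleC_add_left sum.distrib)
  have "Poly_Mapping.keys (c *\<^sub>C p) \<subseteq> Poly_Mapping.keys p"
    by (auto simp: in_keys_iff lookup_scaleC)
  then show "free_extend f (c *\<^sub>C p) = c *\<^sub>C free_extend f p"
    by (simp add: free_extend_superset[of "Poly_Mapping.keys p"] lookup_scaleC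
        complex_vector.scale_sum_right scaleC_scaleC scaleC_complex_def)
qed

lemma free_extend_single: "free_extend f (Poly_Mapping.single (a, b) 1) = f a b"
  by (simp add: free_extend_def scaleC_one)

lemma free_extend_relators:
  assumes f: "cbilinear f" and p: "p \<in> cspan tensor_relators"
  shows "free_extend f p = 0"
  using p
proof (induction rule: complex_vector.span_induct)
  case base
  show ?case
    unfolding complex_vector.subspace_def
    by (simp add: clinear_add[OF clinear_free_extend] clinear_scaleC[OF clinear_free_extend]
        clinear_zero[OF clinear_free_extend])
next
  case (step p)
  then show ?case
    unfolding tensor_relators_def
    by (elim UnE CollectE exE; simp add: clinear_diff[OF clinear_free_extend]
        clinear_add[OF clinear_free_extend] clinear_scaleC[OF clinear_free_extend]
        free_extend_single cbilinear_simps[OF f])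
qed

(* The linear map on the tensor product induced by a bilinear map f; the value 0 for f that are
   not bilinear is a dummy. *)
lift_definition tensor_lift ::
    "('a::complex_vector \<Rightarrow> 'b::complex_vector \<Rightarrow> 'c::complex_vector) \<Rightarrow> 'a \<otimes> 'b \<Rightarrow> 'c"
  is "\<lambda>f p. if cbilinear f then free_extend f p else 0"
proof -
  fix f :: "'a \<Rightarrow> 'b \<Rightarrow> 'c" and p q :: "('a \<times> 'b) \<Rightarrow>\<^sub>0 complex"
  assume "tensor_rel p q"
  then have "free_extend f p - free_extend f q = 0" if "cbilinear f"
    using that free_extend_relators[of f "p - q"]
    by (simp add: tensor_rel_def clinear_diff[OF clinear_free_extend])
  then show "(if cbilinear f then free_extend f p else 0) =
      (if cbilinear f then free_extend f q else 0)"
    by simp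
qed

lemma cbilinear_tensor: "cbilinear (\<otimes>\<^sub>t)"
proof (rule cbilinearI)
  fix x x' :: 'a and y y' :: 'b and c :: complex
  show "x \<otimes>\<^sub>t (y + y') = x \<otimes>\<^sub>t y + x \<otimes>\<^sub>t y'"
    unfolding tensor.abs_eq plus_tensor.abs_eq tensor.abs_eq_iff tensor_rel_def
    by (rule complex_vector.span_base, unfold tensor_relators_def) blast
  show "x \<otimes>\<^sub>t c *\<^sub>C y = c *\<^sub>C (x \<otimes>\<^sub>t y)"
    unfolding tensor.abs_eq scaleC_tensor.abs_eq tensor.abs_eq_iff tensor_rel_def
    by (rule complex_vector.span_base, unfold tensor_relators_def) blast
  show "(x + x') \<otimes>\<^sub>t y = x \<otimes>\<^sub>t y + x' \<otimes>\<^sub>t y"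
    unfolding tensor.abs_eq plus_tensor.abs_eq tensor.abs_eq_iff tensor_rel_def
    by (rule complex_vector.span_base, unfold tensor_relators_def) blast
  show "(c *\<^sub>C x) \<otimes>\<^sub>t y = c *\<^sub>C (x \<otimes>\<^sub>t y)"
    unfolding tensor.abs_eq scaleC_tensor.abs_eq tensor.abs_eq_iff tensor_rel_def
    by (rule complex_vector.span_base, unfold tensor_relators_def) blast
qed

lemmas tensor_simps = cbilinear_simps[OF cbilinear_tensor]

lemma tensor_lift_tensor [simp]: "cbilinear f \<Longrightarrow> tensor_lift f (a \<otimes>\<^sub>t b) = f a b"
  by transfer (simp add: free_extend_single)

lemma clinear_tensor_lift: "clinear (tensor_lift f)"
  by (rule clinearI; transfer)
    (simp_all add: clinear_add[OF clinear_free_extend] clinear_scaleC[OF clinear_free_extend])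

lemma tensor_induct [case_names tensor add]:
  fixes x :: "'a::complex_vector \<otimes> 'b::complex_vector"
  assumes tensor: "\<And>a b. P (a \<otimes>\<^sub>t b)" and add: "\<And>x y. P x \<Longrightarrow> P y \<Longrightarrow> P (x + y)"
  shows "P x"
proof -
  obtain p where x: "x = abs_tensor p" by (induct x rule: tensor.abs_induct) blast
  have "P (abs_tensor p)"
  proof (induction p rule: update_induct)
    case const
    have "abs_tensor 0 = (0 :: 'a) \<otimes>\<^sub>t (0 :: 'b)"
      using tensor_simps(2)[of "0 :: 'a" 0 "0 :: 'b"] by (simp add: zero_tensor_def)
    then show ?case by (metis tensor)
  next
    case (update f k c)
    obtain a b where k: "k = (a, b)" by (cases k)
    have "Poly_Mapping.update k c f = f + c *\<^sub>C Poly_Mapping.single k 1"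
      using update.hyps(1)
      by (intro poly_mapping_eqI)
        (auto simp: lookup_update lookup_add lookup_scaleC lookup_single scaleC_complex_def
          in_keys_iff when_def)
    then have "abs_tensor (Poly_Mapping.update k c f) = abs_tensor f + (c *\<^sub>C a) \<otimes>\<^sub>t b"
      by (simp only: k tensor_simps)
        (simp only: tensor.abs_eq plus_tensor.abs_eq scaleC_tensor.abs_eq)
    then show ?case using update.IH tensor add by metis
  qed
  with x show ?thesis by simp
qed


lemma tensor_map_eqI:
  assumes "clinear f" "clinear g" "\<And>a b. f (a \<otimes>\<^sub>t b) = g (a \<otimes>\<^sub>t b)"
  shows "f x = g x"
  by (induction x rule: tensor_induct)
    (simp_all add: assms(3) clinear_add[OF assms(1)] clinear_add[OF assms(2)])

lemma tensor_lift_add: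
  assumes "cbilinear f" "cbilinear g" "\<And>a b. h a b = f a b + g a b"
  shows "tensor_lift h x = tensor_lift f x + tensor_lift g x"
proof -
  have h: "cbilinear h"
    by (rule cbilinearI)
      (simp_all add: assms(3) cbilinear_simps[OF assms(1)] cbilinear_simps[OF assms(2)]
        scaleC_add_right)
  have eq: "tensor_lift h (a \<otimes>\<^sub>t b) = tensor_lift f (a \<otimes>\<^sub>t b) + tensor_lift g (a \<otimes>\<^sub>t b)" for a b
    by (simp only: tensor_lift_tensor[OF h] tensor_lift_tensor assms)
  show ?thesis
    by (rule tensor_map_eqI)
      (simp_all add: eq clinear_tensor_lift clinear_add[OF clinear_tensor_lift]
        clinear_scaleC[OF clinear_tensor_lift] scaleC_add_right clinearI)
qed

lemma tensor_lift_scaleC: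
  assumes "cbilinear f" "\<And>a b. h a b = c *\<^sub>C f a b"
  shows "tensor_lift h x = c *\<^sub>C tensor_lift f x"
proof -
  have h: "cbilinear h"
    by (rule cbilinearI)
      (simp_all add: assms(2) cbilinear_simps[OF assms(1)] scaleC_add_right scaleC_scaleC
        mult.commute)
  have eq: "tensor_lift h (a \<otimes>\<^sub>t b) = c *\<^sub>C tensor_lift f (a \<otimes>\<^sub>t b)" for a b
    by (simp only: tensor_lift_tensor[OF h] tensor_lift_tensor assms)
  show ?thesis
    by (rule tensor_map_eqI)
      (simp_all add: eq clinear_tensor_lift clinear_add[OF clinear_tensor_lift]
        clinear_scaleC[OF clinear_tensor_lift] scaleC_add_right scaleC_scaleC mult.commute clinearI)
qed

instantiation tensor :: (complex_algebra, complex_algebra) complex_algebra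
begin

definition times_tensor :: "'a \<otimes> 'b \<Rightarrow> 'a \<otimes> 'b \<Rightarrow> 'a \<otimes> 'b" where
  "x * y = tensor_lift (\<lambda>a b. tensor_lift (\<lambda>c d. (a * c) \<otimes>\<^sub>t (b * d)) y) x"

lemma cbilinear_times_inner: "cbilinear (\<lambda>c d. (a * c) \<otimes>\<^sub>t (b * d))"
  for a :: 'a and b :: 'b
  by (rule cbilinearI) (simp_all add: tensor_simps distrib_left mult_scaleC_right)

lemma cbilinear_times_outer: "cbilinear (\<lambda>a b. tensor_lift (\<lambda>c d. (a * c) \<otimes>\<^sub>t (b * d)) y)"
  for y :: "'a \<otimes> 'b"
  by (rule cbilinearI)
    (rule tensor_lift_add tensor_lift_scaleC;
      simp add: cbilinear_times_inner tensor_simps distrib_right mult_scaleC_left)+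

lemma tensor_times_tensor: "(a \<otimes>\<^sub>t b) * (c \<otimes>\<^sub>t d) = (a * c) \<otimes>\<^sub>t (b * d)"
  for a c :: 'a and b d :: 'b
  unfolding times_tensor_def
  by (subst tensor_lift_tensor[OF cbilinear_times_outer]) (simp add: cbilinear_times_inner)

lemma cbilinear_times_tensor: "cbilinear ((*) :: 'a \<otimes> 'b \<Rightarrow> 'a \<otimes> 'b \<Rightarrow> 'a \<otimes> 'b)"
proof (rule cbilinearI)
  fix x y z :: "'a \<otimes> 'b" and c :: complex
  show "(x + y) * z = x * z + y * z"
    by (simp add: times_tensor_def clinear_add[OF clinear_tensor_lift])
  show "(c *\<^sub>C x) * z = c *\<^sub>C (x * z)"
    by (simp add: times_tensor_def clinear_scaleC[OF clinear_tensor_lift])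
  show "x * (y + z) = x * y + x * z"
    unfolding times_tensor_def
    by (rule tensor_lift_add) (simp_all add: cbilinear_times_outer clinear_add[OF clinear_tensor_lift])
  show "x * (c *\<^sub>C z) = c *\<^sub>C (x * z)"
    unfolding times_tensor_def
    by (rule tensor_lift_scaleC)
      (simp_all add: cbilinear_times_outer clinear_scaleC[OF clinear_tensor_lift])
qed

instance
proof
  fix x y z :: "'a \<otimes> 'b" and c :: complex
  note simps = cbilinear_simps[OF cbilinear_times_tensor]
  show "(x + y) * z = x * z + y * z" "x * (y + z) = x * y + x * z"
    "(c *\<^sub>C x) * y = c *\<^sub>C (x * y)" "x * (c *\<^sub>C y) = c *\<^sub>C (x * y)"
    by (rule simps)+
  show "x * y * z = x * (y * z)"
  proof (induction x rule: tensor_induct)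
    case (tensor a b)
    show ?case
    proof (induction y rule: tensor_induct)
      case (tensor a' b')
      show ?case
        by (induction z rule: tensor_induct)
          (simp_all add: tensor_times_tensor mult.assoc simps)
    qed (simp add: simps)
  qed (simp add: simps)
qed

end

section \<open>The multiplier algebra\<close>

(* A multiplier m is the pair of maps L x = m x and R x = x m.  The module property of L and R
   and their linearity follow from x (L y) = (R x) y when the algebra is non-degenerate; they are
   included so that the multipliers form an algebra in general. *)
typedef (overloaded) 'a multiplier =
  "{(L, R). clinear L \<and> clinear R \<and>
     (\<forall>x y :: 'a::complex_algebra. L (x * y) = L x * y) \<and> (\<forall>x y. R (x * y) = x * R y) \<and>
     (\<forall>x y. x * L y = R x * y)}"
  by (rule exI[of _ "(id, id)"]) (simp add: clinear_iff)

setup_lifting type_definition_multiplier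

lift_definition mult_left :: "'a::complex_algebra multiplier \<Rightarrow> 'a \<Rightarrow> 'a" is fst .
lift_definition mult_right :: "'a::complex_algebra multiplier \<Rightarrow> 'a \<Rightarrow> 'a" is snd .

lemma multiplier_eqI:
  "(\<And>x. mult_left m x = mult_left n x) \<Longrightarrow> (\<And>x. mult_right m x = mult_right n x) \<Longrightarrow> m = n"
  by transfer (auto simp: prod_eq_iff)

lemma clinear_mult_left: "clinear (mult_left m)"
  and clinear_mult_right: "clinear (mult_right m)"
  and mult_left_times: "mult_left m (x * y) = mult_left m x * y"
  and mult_right_times: "mult_right m (x * y) = x * mult_right m y"
  and times_mult_left: "x * mult_left m y = mult_right m x * y"
  by (transfer; force)+

lemmas multiplier_simps =
  clinear_add[OF clinear_mult_left] clinear_scaleC[OF clinear_mult_left]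
  clinear_add[OF clinear_mult_right] clinear_scaleC[OF clinear_mult_right]
  mult_left_times mult_right_times times_mult_left

instantiation multiplier :: (complex_algebra) "{complex_algebra, monoid_mult}"
begin

lift_definition zero_multiplier :: "'a multiplier" is "(\<lambda>_. 0, \<lambda>_. 0)"
  by (simp add: clinear_iff)

lift_definition one_multiplier :: "'a multiplier" is "(\<lambda>x. x, \<lambda>x. x)"
  by (simp add: clinear_iff)

lift_definition plus_multiplier :: "'a multiplier \<Rightarrow> 'a multiplier \<Rightarrow> 'a multiplier"
  is "\<lambda>(L, R) (L', R'). (\<lambda>x. L x + L' x, \<lambda>x. R x + R' x)"
  by (auto simp: clinear_iff algebra_simps scaleC_add_right)

lift_definition uminus_multiplier :: "'a multiplier \<Rightarrow> 'a multiplier"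
  is "\<lambda>(L, R). (\<lambda>x. - L x, \<lambda>x. - R x)"
  by (auto simp: clinear_iff)

definition minus_multiplier :: "'a multiplier \<Rightarrow> 'a multiplier \<Rightarrow> 'a multiplier" where
  "m - n = m + - n" for m n :: "'a multiplier"

lift_definition scaleC_multiplier :: "complex \<Rightarrow> 'a multiplier \<Rightarrow> 'a multiplier"
  is "\<lambda>c (L, R). (\<lambda>x. c *\<^sub>C L x, \<lambda>x. c *\<^sub>C R x)"
  by (auto simp: clinear_iff scaleC_add_right scaleC_scaleC mult.commute
      mult_scaleC_left mult_scaleC_right)

lift_definition times_multiplier :: "'a multiplier \<Rightarrow> 'a multiplier \<Rightarrow> 'a multiplier"
  is "\<lambda>(L, R) (L', R'). (\<lambda>x. L (L' x), \<lambda>x. R' (R x))"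
  by (auto simp: clinear_iff)

lemma mult_left_simps [simp]:
  "mult_left 0 x = 0" "mult_left 1 x = x" "mult_left (m + n) x = mult_left m x + mult_left n x"
  "mult_left (- m) x = - mult_left m x" "mult_left (c *\<^sub>C m) x = c *\<^sub>C mult_left m x"
  "mult_left (m * n) x = mult_left m (mult_left n x)"
  by (transfer; force)+

lemma mult_right_simps [simp]:
  "mult_right 0 x = 0" "mult_right 1 x = x" "mult_right (m + n) x = mult_right m x + mult_right n x"
  "mult_right (- m) x = - mult_right m x" "mult_right (c *\<^sub>C m) x = c *\<^sub>C mult_right m x"
  "mult_right (m * n) x = mult_right n (mult_right m x)"
  by (transfer; force)+

instance
  by standard
    (auto intro!: multiplier_eqI simp: minus_multiplier_def scaleC_add_right scaleC_add_left
      scaleC_scaleC scaleC_one multiplier_simps algebra_simps)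

end

lift_definition mult_of :: "'a::complex_algebra \<Rightarrow> 'a multiplier"
  is "\<lambda>a. (\<lambda>x. a * x, \<lambda>x. x * a)"
  by (auto simp: clinear_iff distrib_left distrib_right mult_scaleC_left mult_scaleC_right mult.assoc)

lemma mult_of_simps [simp]: "mult_left (mult_of a) x = a * x" "mult_right (mult_of a) x = x * a"
  by (transfer; simp)+

lemma algebra_hom_mult_of: "algebra_hom mult_of"
  by (auto simp: algebra_hom_def clinear_iff distrib_left distrib_right
      mult_scaleC_left mult_scaleC_right mult.assoc intro!: multiplier_eqI)

section \<open>Coproducts\<close>

definition tensor_map ::
    "('a::complex_vector \<Rightarrow> 'c::complex_vector) \<Rightarrow> ('b::complex_vector \<Rightarrow> 'd::complex_vector)
      \<Rightarrow> 'a \<otimes> 'b \<Rightarrow> 'c \<otimes> 'd" where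
  "tensor_map f g = tensor_lift (\<lambda>a b. f a \<otimes>\<^sub>t g b)"

lemma clinear_tensor_map: "clinear (tensor_map f g)"
  by (simp add: tensor_map_def clinear_tensor_lift)

lemma cbilinear_tensor_map_aux: "clinear f \<Longrightarrow> clinear g \<Longrightarrow> cbilinear (\<lambda>a b. f a \<otimes>\<^sub>t g b)"
  by (rule cbilinearI) (simp_all add: clinear_iff tensor_simps)

lemma tensor_map_tensor:
  "clinear f \<Longrightarrow> clinear g \<Longrightarrow> tensor_map f g (a \<otimes>\<^sub>t b) = f a \<otimes>\<^sub>t g b"
  by (simp add: tensor_map_def cbilinear_tensor_map_aux)

lemma tensor_biclinear_eqI:
  fixes f g :: "'a::complex_vector \<otimes> 'b::complex_vector \<Rightarrow> 'c::complex_vector \<otimes> 'd::complex_vector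
    \<Rightarrow> 'e::complex_vector"
  assumes "cbilinear f" "cbilinear g"
    and "\<And>a b c d. f (a \<otimes>\<^sub>t b) (c \<otimes>\<^sub>t d) = g (a \<otimes>\<^sub>t b) (c \<otimes>\<^sub>t d)"
  shows "f x y = g x y"
proof (induction x rule: tensor_induct)
  case (tensor a b)
  show ?case
    by (induction y rule: tensor_induct)
      (simp_all add: assms(3) cbilinear_add_right[OF assms(1)] cbilinear_add_right[OF assms(2)])
next
  case (add x y)
  then show ?case
    by (simp add: cbilinear_add_left[OF assms(1)] cbilinear_add_left[OF assms(2)])
qed

lemmas algebra_bilinear_simps = distrib_left distrib_right mult_scaleC_left mult_scaleC_right

(* For multipliers m of A and n of B, the multiplier m (x) n of the tensor product of A and B. *)
lift_definition mult_tensor ::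
    "'a::complex_algebra multiplier \<Rightarrow> 'b::complex_algebra multiplier \<Rightarrow> ('a \<otimes> 'b) multiplier"
    (infixr \<open>\<otimes>\<^sub>m\<close> 72)
  is "\<lambda>m n. (tensor_map (mult_left m) (mult_left n), tensor_map (mult_right m) (mult_right n))"
proof -
  fix m :: "'a multiplier" and n :: "'b multiplier"
  let ?L = "tensor_map (mult_left m) (mult_left n)"
  let ?R = "tensor_map (mult_right m) (mult_right n)"
  note [simp] = tensor_map_tensor[OF clinear_mult_left clinear_mult_left]
    tensor_map_tensor[OF clinear_mult_right clinear_mult_right] tensor_times_tensor
    clinear_add[OF clinear_tensor_map] clinear_scaleC[OF clinear_tensor_map]
    algebra_bilinear_simps
  have "?L (x * y) = ?L x * y" for x y
    by (rule tensor_biclinear_eqI[of "\<lambda>x y. ?L (x * y)" "\<lambda>x y. ?L x * y"])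
      (simp_all add: cbilinearI mult_left_times)
  moreover have "?R (x * y) = x * ?R y" for x y
    by (rule tensor_biclinear_eqI[of "\<lambda>x y. ?R (x * y)" "\<lambda>x y. x * ?R y"])
      (simp_all add: cbilinearI mult_right_times)
  moreover have "x * ?L y = ?R x * y" for x y
    by (rule tensor_biclinear_eqI[of "\<lambda>x y. x * ?L y" "\<lambda>x y. ?R x * y"])
      (simp_all add: cbilinearI times_mult_left)
  ultimately show "?thesis m n"
    by (simp add: clinear_tensor_map)
qed

lemma mult_left_mult_tensor:
    "mult_left (m \<otimes>\<^sub>m n) = tensor_map (mult_left m) (mult_left n)"
  and mult_right_mult_tensor:
    "mult_right (m \<otimes>\<^sub>m n) = tensor_map (mult_right m) (mult_right n)"
  by (transfer; simp)+

lemma cbilinear_mult_tensor: "cbilinear (\<otimes>\<^sub>m)"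
proof -
  have L: "mult_left (m \<otimes>\<^sub>m n) x = tensor_lift (\<lambda>a b. mult_left m a \<otimes>\<^sub>t mult_left n b) x"
    and R: "mult_right (m \<otimes>\<^sub>m n) x = tensor_lift (\<lambda>a b. mult_right m a \<otimes>\<^sub>t mult_right n b) x"
    for m :: "'a multiplier" and n :: "'b multiplier" and x
    by (simp_all add: mult_left_mult_tensor mult_right_mult_tensor tensor_map_def)
  note aux = cbilinear_tensor_map_aux[OF clinear_mult_left clinear_mult_left]
    cbilinear_tensor_map_aux[OF clinear_mult_right clinear_mult_right]
  show ?thesis
  proof (rule cbilinearI)
    fix m m' :: "'a multiplier" and n n' :: "'b multiplier" and c :: complex
    show "m \<otimes>\<^sub>m (n + n') = m \<otimes>\<^sub>m n + m \<otimes>\<^sub>m n'"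
    proof (rule multiplier_eqI)
      fix x
      show "mult_left (m \<otimes>\<^sub>m (n + n')) x = mult_left (m \<otimes>\<^sub>m n + m \<otimes>\<^sub>m n') x"
        unfolding mult_left_simps L
        by (rule tensor_lift_add) (simp_all add: aux tensor_simps)
      show "mult_right (m \<otimes>\<^sub>m (n + n')) x = mult_right (m \<otimes>\<^sub>m n + m \<otimes>\<^sub>m n') x"
        unfolding mult_right_simps R
        by (rule tensor_lift_add) (simp_all add: aux tensor_simps)
    qed
    show "m \<otimes>\<^sub>m (c *\<^sub>C n) = c *\<^sub>C (m \<otimes>\<^sub>m n)"
    proof (rule multiplier_eqI)
      fix x
      show "mult_left (m \<otimes>\<^sub>m (c *\<^sub>C n)) x = mult_left (c *\<^sub>C (m \<otimes>\<^sub>m n)) x"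
        unfolding mult_left_simps L
        by (rule tensor_lift_scaleC) (simp_all add: aux tensor_simps)
      show "mult_right (m \<otimes>\<^sub>m (c *\<^sub>C n)) x = mult_right (c *\<^sub>C (m \<otimes>\<^sub>m n)) x"
        unfolding mult_right_simps R
        by (rule tensor_lift_scaleC) (simp_all add: aux tensor_simps)
    qed
    show "(m + m') \<otimes>\<^sub>m n = m \<otimes>\<^sub>m n + m' \<otimes>\<^sub>m n"
    proof (rule multiplier_eqI)
      fix x
      show "mult_left ((m + m') \<otimes>\<^sub>m n) x = mult_left (m \<otimes>\<^sub>m n + m' \<otimes>\<^sub>m n) x"
        unfolding mult_left_simps L
        by (rule tensor_lift_add) (simp_all add: aux tensor_simps)
      show "mult_right ((m + m') \<otimes>\<^sub>m n) x = mult_right (m \<otimes>\<^sub>m n + m' \<otimes>\<^sub>m n) x"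
        unfolding mult_right_simps R
        by (rule tensor_lift_add) (simp_all add: aux tensor_simps)
    qed
    show "(c *\<^sub>C m) \<otimes>\<^sub>m n = c *\<^sub>C (m \<otimes>\<^sub>m n)"
    proof (rule multiplier_eqI)
      fix x
      show "mult_left ((c *\<^sub>C m) \<otimes>\<^sub>m n) x = mult_left (c *\<^sub>C (m \<otimes>\<^sub>m n)) x"
        unfolding mult_left_simps L
        by (rule tensor_lift_scaleC) (simp_all add: aux tensor_simps)
      show "mult_right ((c *\<^sub>C m) \<otimes>\<^sub>m n) x = mult_right (c *\<^sub>C (m \<otimes>\<^sub>m n)) x"
        unfolding mult_right_simps R
        by (rule tensor_lift_scaleC) (simp_all add: aux tensor_simps)
    qed
  qed
qed

definition tensor_assoc ::
    "('a::complex_vector \<otimes> 'b::complex_vector) \<otimes> 'c::complex_vector \<Rightarrow> 'a \<otimes> ('b \<otimes> 'c)" where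
  "tensor_assoc = tensor_lift (\<lambda>x c. tensor_lift (\<lambda>a b. a \<otimes>\<^sub>t (b \<otimes>\<^sub>t c)) x)"

definition tensor_assoc_inv ::
    "'a::complex_vector \<otimes> ('b::complex_vector \<otimes> 'c::complex_vector) \<Rightarrow> ('a \<otimes> 'b) \<otimes> 'c" where
  "tensor_assoc_inv = tensor_lift (\<lambda>a x. tensor_lift (\<lambda>b c. (a \<otimes>\<^sub>t b) \<otimes>\<^sub>t c) x)"


lemma cbilinear_assoc_inner: "cbilinear (\<lambda>a b. a \<otimes>\<^sub>t (b \<otimes>\<^sub>t c))"
  and cbilinear_assoc_inv_inner: "cbilinear (\<lambda>b c. (a \<otimes>\<^sub>t b) \<otimes>\<^sub>t c)"
  by (rule cbilinearI; simp add: tensor_simps)+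

lemma cbilinear_assoc_outer: "cbilinear (\<lambda>x c. tensor_lift (\<lambda>a b. a \<otimes>\<^sub>t (b \<otimes>\<^sub>t c)) x)"
  by (rule cbilinearI)
    ((rule tensor_lift_add tensor_lift_scaleC;
      simp add: cbilinear_assoc_inner tensor_simps) |
     simp add: clinear_add[OF clinear_tensor_lift] clinear_scaleC[OF clinear_tensor_lift])+

lemma cbilinear_assoc_inv_outer: "cbilinear (\<lambda>a x. tensor_lift (\<lambda>b c. (a \<otimes>\<^sub>t b) \<otimes>\<^sub>t c) x)"
  by (rule cbilinearI)
    ((rule tensor_lift_add tensor_lift_scaleC;
      simp add: cbilinear_assoc_inv_inner tensor_simps) |
     simp add: clinear_add[OF clinear_tensor_lift] clinear_scaleC[OF clinear_tensor_lift])+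

lemma tensor_assoc_tensor [simp]: "tensor_assoc ((a \<otimes>\<^sub>t b) \<otimes>\<^sub>t c) = a \<otimes>\<^sub>t (b \<otimes>\<^sub>t c)"
  unfolding tensor_assoc_def
  by (subst tensor_lift_tensor[OF cbilinear_assoc_outer]) (simp add: cbilinear_assoc_inner)

lemma tensor_assoc_inv_tensor [simp]: "tensor_assoc_inv (a \<otimes>\<^sub>t (b \<otimes>\<^sub>t c)) = (a \<otimes>\<^sub>t b) \<otimes>\<^sub>t c"
  unfolding tensor_assoc_inv_def
  by (subst tensor_lift_tensor[OF cbilinear_assoc_inv_outer]) (simp add: cbilinear_assoc_inv_inner)

lemma clinear_tensor_assoc: "clinear tensor_assoc"
  and clinear_tensor_assoc_inv: "clinear tensor_assoc_inv"
  by (simp_all add: tensor_assoc_def tensor_assoc_inv_def clinear_tensor_lift)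

lemmas tensor_assoc_simps =
  clinear_add[OF clinear_tensor_assoc] clinear_scaleC[OF clinear_tensor_assoc]
  clinear_add[OF clinear_tensor_assoc_inv] clinear_scaleC[OF clinear_tensor_assoc_inv]

lemma tensor_assoc_inverse [simp]: "tensor_assoc_inv (tensor_assoc x) = x"
proof (induction x rule: tensor_induct)
  case (tensor y c)
  show ?case
    by (induction y rule: tensor_induct) (simp_all add: tensor_assoc_simps tensor_simps)
qed (simp add: tensor_assoc_simps)

lemma tensor_assoc_inv_inverse [simp]: "tensor_assoc (tensor_assoc_inv x) = x"
proof (induction x rule: tensor_induct)
  case (tensor a y)
  show ?case
    by (induction y rule: tensor_induct) (simp_all add: tensor_assoc_simps tensor_simps)
qed (simp add: tensor_assoc_simps)

lemma tensor_assoc_times: "tensor_assoc (x * y) = tensor_assoc x * tensor_assoc y"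
proof (rule tensor_biclinear_eqI[of "\<lambda>x y. tensor_assoc (x * y)"
      "\<lambda>x y. tensor_assoc x * tensor_assoc y"])
  show "cbilinear (\<lambda>x y. tensor_assoc (x * y))"
    "cbilinear (\<lambda>x y. tensor_assoc x * tensor_assoc y)"
    by (rule cbilinearI; simp add: algebra_bilinear_simps tensor_assoc_simps)+
  fix x y :: "'a \<otimes> 'b" and c d :: 'c
  show "tensor_assoc ((x \<otimes>\<^sub>t c) * (y \<otimes>\<^sub>t d)) = tensor_assoc (x \<otimes>\<^sub>t c) * tensor_assoc (y \<otimes>\<^sub>t d)"
    by (rule tensor_biclinear_eqI[of "\<lambda>x y. tensor_assoc ((x \<otimes>\<^sub>t c) * (y \<otimes>\<^sub>t d))"
          "\<lambda>x y. tensor_assoc (x \<otimes>\<^sub>t c) * tensor_assoc (y \<otimes>\<^sub>t d)"])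
      (simp_all add: cbilinearI algebra_bilinear_simps tensor_assoc_simps tensor_simps
        tensor_times_tensor)
qed

lemma tensor_assoc_inv_times:
  "tensor_assoc_inv (x * y) = tensor_assoc_inv x * tensor_assoc_inv y"
  by (metis tensor_assoc_inv_inverse tensor_assoc_inverse tensor_assoc_times)

(* The identification of the two multiplier algebras that is induced by the identification
   of the two bracketings of a triple tensor product. *)
lift_definition multiplier_assoc ::
    "(('a::complex_algebra \<otimes> 'b::complex_algebra) \<otimes> 'c::complex_algebra) multiplier
      \<Rightarrow> ('a \<otimes> ('b \<otimes> 'c)) multiplier"
  is "\<lambda>m. (\<lambda>x. tensor_assoc (mult_left m (tensor_assoc_inv x)),
           \<lambda>x. tensor_assoc (mult_right m (tensor_assoc_inv x)))"
proof -
  fix m :: "(('a \<otimes> 'b) \<otimes> 'c) multiplier"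
  have "x * tensor_assoc (mult_left m (tensor_assoc_inv y)) =
      tensor_assoc (mult_right m (tensor_assoc_inv x)) * y" for x y
    by (metis tensor_assoc_inv_inverse tensor_assoc_times times_mult_left)
  then show "?thesis m"
    by (simp add: clinear_iff tensor_assoc_simps tensor_assoc_times tensor_assoc_inv_times
        clinear_add[OF clinear_mult_left] clinear_scaleC[OF clinear_mult_left]
        clinear_add[OF clinear_mult_right] clinear_scaleC[OF clinear_mult_right]
        mult_left_times mult_right_times)
qed

(* The map (D (x) id) from the tensor product of A and C to the multiplier algebra of the tensor
   product of B and C, for a linear map D from A to M(B); id_tensor is the mirror image. *)
definition tensor_id ::
    "('a::complex_algebra \<Rightarrow> 'b::complex_algebra multiplier)
      \<Rightarrow> 'a \<otimes> 'c::complex_algebra \<Rightarrow> ('b \<otimes> 'c) multiplier" where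
  "tensor_id D = tensor_lift (\<lambda>p q. D p \<otimes>\<^sub>m mult_of q)"

definition id_tensor ::
    "('a::complex_algebra \<Rightarrow> 'b::complex_algebra multiplier)
      \<Rightarrow> 'c::complex_algebra \<otimes> 'a \<Rightarrow> ('c \<otimes> 'b) multiplier" where
  "id_tensor D = tensor_lift (\<lambda>p q. mult_of p \<otimes>\<^sub>m D q)"

lemma clinear_mult_of: "clinear mult_of"
  by (rule conjunct1[OF algebra_hom_mult_of[unfolded algebra_hom_def]])

lemma tensor_id_tensor: "clinear D \<Longrightarrow> tensor_id D (p \<otimes>\<^sub>t q) = D p \<otimes>\<^sub>m mult_of q"
  unfolding tensor_id_def
  by (rule tensor_lift_tensor, rule cbilinearI)
    (simp_all add: clinear_iff cbilinear_simps[OF cbilinear_mult_tensor]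
      clinear_add[OF clinear_mult_of] clinear_scaleC[OF clinear_mult_of])

lemma id_tensor_tensor: "clinear D \<Longrightarrow> id_tensor D (p \<otimes>\<^sub>t q) = mult_of p \<otimes>\<^sub>m D q"
  unfolding id_tensor_def
  by (rule tensor_lift_tensor, rule cbilinearI)
    (simp_all add: clinear_iff cbilinear_simps[OF cbilinear_mult_tensor]
      clinear_add[OF clinear_mult_of] clinear_scaleC[OF clinear_mult_of])

(* The elements s and t of the tensor square are those that D b (1 (x) c) and (a (x) 1) D b are
   identified with by the embedding of an algebra into its multiplier algebra. *)
definition coassociative ::
    "('a::complex_algebra \<Rightarrow> ('a \<otimes> 'a) multiplier) \<Rightarrow> bool" where
  "coassociative D \<longleftrightarrow>
     (\<forall>a b c s t. D b * (1 \<otimes>\<^sub>m mult_of c) = mult_of s \<longrightarrow> (mult_of a \<otimes>\<^sub>m 1) * D b = mult_of t \<longrightarrow>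
        multiplier_assoc (((mult_of a \<otimes>\<^sub>m 1) \<otimes>\<^sub>m 1) * tensor_id D s) =
        id_tensor D t * (1 \<otimes>\<^sub>m (1 \<otimes>\<^sub>m mult_of c)))"

definition coproduct :: "('a::complex_algebra \<Rightarrow> ('a \<otimes> 'a) multiplier) \<Rightarrow> bool" where
  "coproduct D \<longleftrightarrow>
     algebra_hom D \<and>
     (\<forall>a b. D a * (1 \<otimes>\<^sub>m mult_of b) \<in> range mult_of) \<and>
     (\<forall>a b. (mult_of a \<otimes>\<^sub>m 1) * D b \<in> range mult_of) \<and>
     coassociative D"

end

(* For a multiplier m of A and x in A (x) A, the element z = \<Delta>\<^sub>1(m) x must satisfy E z = z and
   \<Delta>(c) z = \<Delta>(c m) x for all c in A.  These equations determine z, because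
   (A (x) A) \<Delta>(A) = (A (x) A) E and A (x) A is non-degenerate; and they can be solved: write
   E x as a sum of terms \<Delta>(a) b and take the sum of the \<Delta>(m a) b.  Hence uniqueness of \<Delta>\<^sub>1 and all
   algebraic identities for it follow by checking the two equations. *)
theory Submission
  imports Defs
begin

section \<open>Cancellation, and multipliers determined by one of their two sides\<close>

section \<open>Non-degenerate algebras\<close>

lemma mult_left_add: "mult_left m (x + y) = mult_left m x + mult_left m y"
  and mult_left_scaleC: "mult_left m (c *\<^sub>C x) = c *\<^sub>C mult_left m x"
  and mult_left_zero: "mult_left m 0 = 0"
  and mult_right_add: "mult_right m (x + y) = mult_right m x + mult_right m y"
  and mult_right_scaleC: "mult_right m (c *\<^sub>C x) = c *\<^sub>C mult_right m x"
  and mult_right_zero: "mult_right m 0 = 0"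
  by (simp_all add: clinear_add[OF clinear_mult_left] clinear_scaleC[OF clinear_mult_left]
      clinear_zero[OF clinear_mult_left] clinear_add[OF clinear_mult_right]
      clinear_scaleC[OF clinear_mult_right] clinear_zero[OF clinear_mult_right])

lemma nondegenerate_eqI_left:
  fixes x y :: "'a::complex_algebra"
  assumes "nondegenerate TYPE('a)" "\<And>z. z * x = z * y"
  shows "x = y"
proof -
  have "z * (x - y) = 0" for z
    by (simp add: right_diff_distrib assms(2))
  then have "x - y = 0" using assms(1) unfolding nondegenerate_def by blast
  then show ?thesis by simp
qed

lemma nondegenerate_eqI_right:
  fixes x y :: "'a::complex_algebra"
  assumes "nondegenerate TYPE('a)" "\<And>z. x * z = y * z"
  shows "x = y"
proof -
  have "(x - y) * z = 0" for z
    by (simp add: left_diff_distrib assms(2))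
  then have "x - y = 0" using assms(1) unfolding nondegenerate_def by blast
  then show ?thesis by simp
qed

text \<open>The balance identity \<open>x * mult_left m y = mult_right m x * y\<close> passes
  equality from the left to the right action, since multiplication by all \<open>y\<close> separates
  elements.\<close>

lemma multiplier_eqI_left:
  fixes m n :: "'a::complex_algebra multiplier"
  assumes "nondegenerate TYPE('a)" "\<And>x. mult_left m x = mult_left n x"
  shows "m = n"
proof (rule multiplier_eqI)
  show "mult_left m x = mult_left n x" for x by fact
  show "mult_right m x = mult_right n x" for x
    by (rule nondegenerate_eqI_right[OF assms(1)]) (metis assms(2) times_mult_left)
qed

text \<open>Linearity and the module rules come from \<open>LR\<close> alone: multiply by a test
  element, move the map to the other factor, where the rule is plain algebra, and cancel the test
  element.\<close>

lemma multiplier_exI: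
  fixes L R :: "'a::complex_algebra \<Rightarrow> 'a"
  assumes nd: "nondegenerate TYPE('a)" and LR: "\<And>x y. x * L y = R x * y"
  shows "\<exists>m. mult_left m = L \<and> mult_right m = R"
proof -
  have "clinear L"
    by (rule clinearI; rule nondegenerate_eqI_left[OF nd];
        simp add: LR algebra_bilinear_simps)
  moreover have "clinear R"
    by (rule clinearI; rule nondegenerate_eqI_right[OF nd];
        simp add: LR[symmetric] algebra_bilinear_simps)
  moreover have "L (x * y) = L x * y" for x y
    by (rule nondegenerate_eqI_left[OF nd]) (metis LR mult.assoc)
  moreover have "R (x * y) = x * R y" for x y
    by (rule nondegenerate_eqI_right[OF nd]) (metis LR mult.assoc)
  ultimately have "(L, R) \<in> {(L, R). clinear L \<and> clinear R \<and>
     (\<forall>x y. L (x * y) = L x * y) \<and> (\<forall>x y. R (x * y) = x * R y) \<and> (\<forall>x y. x * L y = R x * y)}"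
    using LR by simp
  then have "Rep_multiplier (Abs_multiplier (L, R)) = (L, R)"
    by (rule Abs_multiplier_inverse)
  then show ?thesis
    by (intro exI[of _ "Abs_multiplier (L, R)"]) (simp add: mult_left.rep_eq mult_right.rep_eq)
qed

lemma mult_of_inj:
  fixes x y :: "'a::complex_algebra"
  assumes "nondegenerate TYPE('a)" "mult_of x = mult_of y"
  shows "x = y"
  by (rule nondegenerate_eqI_left[OF assms(1)]) (metis assms(2) mult_of_simps(2))

lemma mult_of_add: "mult_of (x + y) = mult_of x + mult_of y"
  and mult_of_scaleC: "mult_of (c *\<^sub>C x) = c *\<^sub>C mult_of x"
  and mult_of_zero: "mult_of 0 = 0"
  by (simp_all add: clinear_add[OF clinear_mult_of] clinear_scaleC[OF clinear_mult_of]
      clinear_zero[OF clinear_mult_of])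

text \<open>The algebra is a two-sided ideal of its multiplier algebra; this turns equations between
  multipliers into equations between elements.\<close>

lemma times_mult_of: "m * mult_of x = mult_of (mult_left m x)"
  and mult_of_times: "mult_of x * m = mult_of (mult_right m x)"
  by (auto intro!: multiplier_eqI simp: mult_left_times mult_right_times times_mult_left)

section \<open>Slice maps, separation by linear functionals, and products of tensors\<close>

section \<open>The tensor product of non-degenerate algebras\<close>

text \<open>The slice map f \<otimes> id, with \<complex> \<otimes> B identified with B;
  \<open>slice_right\<close> is its mirror image id \<otimes> f.\<close>

definition slice_left :: "('a::complex_vector \<Rightarrow> complex) \<Rightarrow> 'a \<otimes> 'b::complex_vector \<Rightarrow> 'b" where
  "slice_left f = tensor_lift (\<lambda>a b. f a *\<^sub>C b)"

definition slice_right :: "('b::complex_vector \<Rightarrow> complex) \<Rightarrow> 'a::complex_vector \<otimes> 'b \<Rightarrow> 'a" where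
  "slice_right f = tensor_lift (\<lambda>a b. f b *\<^sub>C a)"

lemma clinear_slice_left: "clinear (slice_left f)"
  and clinear_slice_right: "clinear (slice_right f)"
  by (simp_all add: slice_left_def slice_right_def clinear_tensor_lift)

lemma slice_left_tensor: "clinear f \<Longrightarrow> slice_left f (a \<otimes>\<^sub>t b) = f a *\<^sub>C b"
  unfolding slice_left_def
  by (rule tensor_lift_tensor, rule cbilinearI)
    (simp_all add: clinear_iff scaleC_add_left scaleC_add_right scaleC_scaleC scaleC_complex_def
      mult.commute)

lemma slice_right_tensor: "clinear f \<Longrightarrow> slice_right f (a \<otimes>\<^sub>t b) = f b *\<^sub>C a"
  unfolding slice_right_def
  by (rule tensor_lift_tensor, rule cbilinearI)
    (simp_all add: clinear_iff scaleC_add_left scaleC_add_right scaleC_scaleC scaleC_complex_def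
      mult.commute)

text \<open>Coordinates in a Hamel basis, equal to 0 at vectors outside it. Admitting every finite
  \<open>G\<close> above the support lets several vectors share one index set.\<close>

lemma coordinate_functionals:
  obtains r :: "'a::complex_vector \<Rightarrow> 'a \<Rightarrow> complex"
  where "\<And>b. clinear (r b)"
    and "\<And>v. \<exists>F. finite F \<and> (\<forall>G. finite G \<longrightarrow> F \<subseteq> G \<longrightarrow> v = (\<Sum>b\<in>G. r b v *\<^sub>C b))"
proof
  define B :: "'a set" where "B = complex_vector.extend_basis {}"
  have B: "complex_vector.independent B" "cspan B = UNIV"
    using complex_vector.independent_extend_basis[OF complex_vector.independent_empty]
      complex_vector.span_extend_basis[OF complex_vector.independent_empty]
    by (simp_all add: B_def)
  let ?r = "\<lambda>b v. complex_vector.representation B v b"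
  show "clinear (?r b)" for b
    by (rule clinearI)
      (simp_all add: complex_vector.representation_add complex_vector.representation_scale B
        scaleC_complex_def)
  show "\<exists>F. finite F \<and> (\<forall>G. finite G \<longrightarrow> F \<subseteq> G \<longrightarrow> v = (\<Sum>b\<in>G. ?r b v *\<^sub>C b))" for v
  proof (intro exI conjI allI impI)
    show "finite {b. ?r b v \<noteq> 0}" by (rule complex_vector.finite_representation)
    fix G assume G: "finite G" "{b. ?r b v \<noteq> 0} \<subseteq> G"
    have "(\<Sum>b\<in>{b. ?r b v \<noteq> 0}. ?r b v *\<^sub>C b) = v"
      by (rule complex_vector.sum_nonzero_representation_eq) (simp_all add: B)
    moreover have "(\<Sum>b\<in>{b. ?r b v \<noteq> 0}. ?r b v *\<^sub>C b) = (\<Sum>b\<in>G. ?r b v *\<^sub>C b)"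
      by (rule sum.mono_neutral_left) (use G in auto)
    ultimately show "v = (\<Sum>b\<in>G. ?r b v *\<^sub>C b)" by simp
  qed
qed

lemma clinear_sum: "clinear f \<Longrightarrow> f (sum g A) = (\<Sum>i\<in>A. f (g i))"
  by (induction A rule: infinite_finite_induct) (simp_all add: clinear_zero clinear_add)

lemma clinear_tensor_left: "clinear (\<lambda>a. a \<otimes>\<^sub>t b)"
  and clinear_tensor_right: "clinear (\<lambda>b. a \<otimes>\<^sub>t b)"
  by (simp_all add: clinear_iff tensor_simps)

text \<open>Expanding the second leg in coordinates writes a tensor as a finite sum of its slices
  tensored with fixed vectors, so it vanishes when all its slices do.\<close>

lemma slice_right_eq_0:
  fixes x :: "'a::complex_vector \<otimes> 'b::complex_vector"
  assumes "\<And>f. clinear f \<Longrightarrow> slice_right f x = 0"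
  shows "x = 0"
proof -
  obtain r :: "'b \<Rightarrow> 'b \<Rightarrow> complex" where r: "\<And>b. clinear (r b)"
    and fin: "\<And>v. \<exists>F. finite F \<and> (\<forall>G. finite G \<longrightarrow> F \<subseteq> G \<longrightarrow> v = (\<Sum>b\<in>G. r b v *\<^sub>C b))"
    using coordinate_functionals by blast
  have "\<exists>F. finite F \<and> (\<forall>G. finite G \<longrightarrow> F \<subseteq> G \<longrightarrow> y = (\<Sum>b\<in>G. slice_right (r b) y \<otimes>\<^sub>t b))"
    for y :: "'a \<otimes> 'b"
  proof (induction y rule: tensor_induct)
    case (tensor u v)
    obtain F where F: "finite F" "\<And>G. finite G \<Longrightarrow> F \<subseteq> G \<Longrightarrow> v = (\<Sum>b\<in>G. r b v *\<^sub>C b)"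
      using fin by blast
    have "u \<otimes>\<^sub>t v = (\<Sum>b\<in>G. slice_right (r b) (u \<otimes>\<^sub>t v) \<otimes>\<^sub>t b)" if "finite G" "F \<subseteq> G" for G
    proof -
      have "u \<otimes>\<^sub>t v = u \<otimes>\<^sub>t (\<Sum>b\<in>G. r b v *\<^sub>C b)" using F(2)[OF that] by simp
      also have "\<dots> = (\<Sum>b\<in>G. slice_right (r b) (u \<otimes>\<^sub>t v) \<otimes>\<^sub>t b)"
        by (simp add: clinear_sum[OF clinear_tensor_right] slice_right_tensor[OF r] tensor_simps)
      finally show ?thesis .
    qed
    with F(1) show ?case by blast
  next
    case (add y z)
    then obtain F H where
      F: "finite F" "\<And>G. finite G \<Longrightarrow> F \<subseteq> G \<Longrightarrow> y = (\<Sum>b\<in>G. slice_right (r b) y \<otimes>\<^sub>t b)" and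
      H: "finite H" "\<And>G. finite G \<Longrightarrow> H \<subseteq> G \<Longrightarrow> z = (\<Sum>b\<in>G. slice_right (r b) z \<otimes>\<^sub>t b)"
      by blast
    have "y + z = (\<Sum>b\<in>G. slice_right (r b) (y + z) \<otimes>\<^sub>t b)" if "finite G" "F \<union> H \<subseteq> G" for G
    proof -
      have "y + z = (\<Sum>b\<in>G. slice_right (r b) y \<otimes>\<^sub>t b) + (\<Sum>b\<in>G. slice_right (r b) z \<otimes>\<^sub>t b)"
        using F(2)[of G] H(2)[of G] that by simp
      then show ?thesis
        unfolding clinear_add[OF clinear_slice_right] tensor_simps sum.distrib .
    qed
    with F(1) H(1) show ?case by (intro exI[of _ "F \<union> H"]) simp
  qed
  then obtain F where "x = (\<Sum>b\<in>F. slice_right (r b) x \<otimes>\<^sub>t b)" by blast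
  then show ?thesis
    using assms[OF r] by (simp add: clinear_zero[OF clinear_tensor_left])
qed

text \<open>Both sides are the value of f \<otimes> g at \<open>x\<close>.\<close>

lemma slice_left_functional_slice_right:
  fixes x :: "'a::complex_vector \<otimes> 'b::complex_vector"
  assumes "clinear f" "clinear g"
  shows "g (slice_left f x) = f (slice_right g x)"
  by (induction x rule: tensor_induct)
    (simp_all add: slice_left_tensor slice_right_tensor assms clinear_add[OF clinear_slice_left]
      clinear_add[OF clinear_slice_right] clinear_add[OF assms(1)] clinear_add[OF assms(2)]
      clinear_scaleC[OF assms(1)] clinear_scaleC[OF assms(2)] scaleC_complex_def)

lemma functionals_separate:
  fixes v :: "'a::complex_vector"
  assumes "\<And>f :: 'a \<Rightarrow> complex. clinear f \<Longrightarrow> f v = 0"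
  shows "v = 0"
proof -
  obtain r :: "'a \<Rightarrow> 'a \<Rightarrow> complex" where r: "\<And>b. clinear (r b)"
    and "\<And>v. \<exists>F. finite F \<and> (\<forall>G. finite G \<longrightarrow> F \<subseteq> G \<longrightarrow> v = (\<Sum>b\<in>G. r b v *\<^sub>C b))"
    using coordinate_functionals by blast
  then obtain F where "v = (\<Sum>b\<in>F. r b v *\<^sub>C b)" by blast
  then show ?thesis using assms[OF r] by simp
qed

text \<open>Double slices f \<otimes> g reduce this to right slices, because functionals separate
  vectors.\<close>

lemma slice_left_eq_0:
  fixes x :: "'a::complex_vector \<otimes> 'b::complex_vector"
  assumes "\<And>f. clinear f \<Longrightarrow> slice_left f x = 0"
  shows "x = 0"
proof (rule slice_right_eq_0)
  fix g :: "'b \<Rightarrow> complex" assume g: "clinear g"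
  show "slice_right g x = 0"
    by (rule functionals_separate)
      (simp add: slice_left_functional_slice_right[OF _ g, symmetric] assms clinear_zero[OF g])
qed

text \<open>The factor on the sliced leg is absorbed into the functional; the factor on the other
  leg comes out of the slice.\<close>

lemma slice_right_times_tensor:
  fixes x :: "'a::complex_algebra \<otimes> 'b::complex_algebra"
  assumes "clinear f"
  shows "slice_right f (x * (c \<otimes>\<^sub>t d)) = slice_right (\<lambda>b. f (b * d)) x * c"
    and "slice_right f ((c \<otimes>\<^sub>t d) * x) = c * slice_right (\<lambda>b. f (d * b)) x"
proof -
  have f: "clinear (\<lambda>b. f (b * d))" "clinear (\<lambda>b. f (d * b))"
    using assms by (simp_all add: clinear_iff algebra_bilinear_simps)
  show "slice_right f (x * (c \<otimes>\<^sub>t d)) = slice_right (\<lambda>b. f (b * d)) x * c"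
    "slice_right f ((c \<otimes>\<^sub>t d) * x) = c * slice_right (\<lambda>b. f (d * b)) x"
    by (induction x rule: tensor_induct)
      (simp_all add: tensor_times_tensor slice_right_tensor assms f algebra_bilinear_simps
        clinear_add[OF clinear_slice_right])
qed

lemma slice_left_functional_times:
  fixes x :: "'a::complex_algebra \<otimes> 'b::complex_algebra"
  assumes "clinear f" "clinear g"
  shows "g (slice_left f x * d) = f (slice_right (\<lambda>b. g (b * d)) x)"
    and "g (d * slice_left f x) = f (slice_right (\<lambda>b. g (d * b)) x)"
proof -
  have "clinear (\<lambda>b. g (b * d))" "clinear (\<lambda>b. g (d * b))"
    using assms(2) by (simp_all add: clinear_iff algebra_bilinear_simps)
  then show "g (slice_left f x * d) = f (slice_right (\<lambda>b. g (b * d)) x)"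
    "g (d * slice_left f x) = f (slice_right (\<lambda>b. g (d * b)) x)"
    using slice_left_functional_slice_right[OF assms(1)] by blast+
qed

text \<open>If \<open>x\<close> kills every \<open>c \<otimes>\<^sub>t d\<close>, its right slices
  by the shifted functionals kill every \<open>c\<close> and vanish by non-degeneracy of the first
  algebra. Functionals then show that its left slices kill every \<open>d\<close>, so these vanish
  by non-degeneracy of the second.\<close>

lemma nondegenerate_tensor:
  assumes A: "nondegenerate TYPE('a::complex_algebra)" and B: "nondegenerate TYPE('b::complex_algebra)"
  shows "nondegenerate TYPE('a \<otimes> 'b)"
  unfolding nondegenerate_def
proof (intro conjI allI impI)
  fix x :: "'a \<otimes> 'b"
  assume x: "\<forall>y. x * y = 0"
  have *: "slice_right (\<lambda>b. g (b * d)) x = 0" if "clinear g" for g d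
  proof (rule nondegenerate_eqI_right[OF A])
    show "slice_right (\<lambda>b. g (b * d)) x * c = 0 * c" for c
      using slice_right_times_tensor(1)[OF that, of x c d] x
      by (simp add: clinear_zero[OF clinear_slice_right])
  qed
  show "x = 0"
  proof (rule slice_left_eq_0, rule nondegenerate_eqI_right[OF B])
    fix f :: "'a \<Rightarrow> complex" and d assume f: "clinear f"
    have "slice_left f x * d = 0"
      by (rule functionals_separate)
        (simp add: slice_left_functional_times[OF f] * clinear_zero[OF f])
    then show "slice_left f x * d = 0 * d" by simp
  qed
next
  fix x :: "'a \<otimes> 'b"
  assume x: "\<forall>y. y * x = 0"
  have *: "slice_right (\<lambda>b. g (d * b)) x = 0" if "clinear g" for g d
  proof (rule nondegenerate_eqI_left[OF A])
    show "c * slice_right (\<lambda>b. g (d * b)) x = c * 0" for c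
      using slice_right_times_tensor(2)[OF that, of c d x] x
      by (simp add: clinear_zero[OF clinear_slice_right])
  qed
  show "x = 0"
  proof (rule slice_left_eq_0, rule nondegenerate_eqI_left[OF B])
    fix f :: "'a \<Rightarrow> complex" and d assume f: "clinear f"
    have "d * slice_left f x = 0"
      by (rule functionals_separate)
        (simp add: slice_left_functional_times[OF f] * clinear_zero[OF f])
    then show "d * slice_left f x = d * 0" by simp
  qed
qed

section \<open>From a homomorphism into M(B) to its extension through two defining equations\<close>

section \<open>Extension of homomorphisms to the multiplier algebra\<close>

text \<open>A combination of embedded elements is the embedding of the same combination, and the
  embedding is injective.\<close>

lemma mult_of_span:
  fixes S :: "'b::complex_algebra set"
  assumes nd: "nondegenerate TYPE('b)" and x: "mult_of x \<in> cspan (mult_of ` S)"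
  shows "x \<in> cspan S"
proof -
  have "\<exists>y \<in> cspan S. mult_of y = m" if "m \<in> cspan (mult_of ` S)" for m
    using that
  proof (induction rule: complex_vector.span_induct_alt)
    case base
    show ?case using complex_vector.span_zero mult_of_zero by blast
  next
    case (step c n m)
    then obtain s y where "s \<in> S" "n = mult_of s" "y \<in> cspan S" "mult_of y = m" by blast
    then show ?case
      by (intro bexI[of _ "c *\<^sub>C s + y"])
        (simp_all add: mult_of_add mult_of_scaleC complex_vector.span_add
          complex_vector.span_scale complex_vector.span_base)
  qed
  with x show ?thesis using mult_of_inj[OF nd] by blast
qed

text \<open>A general non-degenerate algebra B takes the place of A \<otimes> A. The two range
  conditions read E B = D(A) B and B E = B D(A) inside M(B).\<close>

locale hom_with_unit =
  fixes D :: "'a::complex_algebra \<Rightarrow> 'b::complex_algebra multiplier" and E :: "'b multiplier"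
  assumes nd: "nondegenerate TYPE('b)"
    and hom: "algebra_hom D"
    and idem: "E * E = E"
    and left_range: "(*) E ` range mult_of = range D \<odot> range mult_of"
    and right_range: "(\<lambda>x. x * E) ` range mult_of = range mult_of \<odot> range D"
begin

lemma D_times: "D (a * b) = D a * D b"
  using hom by (simp add: algebra_hom_def)

lemma left_generators: "{s * t |s t. s \<in> range D \<and> t \<in> range mult_of} =
    mult_of ` {mult_left (D a) b |a b. True}"
  by (auto simp: image_def simp flip: times_mult_of) (metis times_mult_of)+

lemma right_generators: "{s * t |s t. s \<in> range mult_of \<and> t \<in> range D} =
    mult_of ` {mult_right (D a) b |a b. True}"
  by (auto simp: image_def simp flip: mult_of_times) (metis mult_of_times)+

text \<open>Restates the inclusion of E B in D(A) B for elements, so that statements about E x can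
  be proved by induction over sums of terms D(a) b.\<close>

lemma E_left_span: "mult_left E x \<in> cspan {mult_left (D a) b |a b. True}"
proof (rule mult_of_span[OF nd])
  have "E * mult_of x \<in> (*) E ` range mult_of" by simp
  then show "mult_of (mult_left E x) \<in> cspan (mult_of ` {mult_left (D a) b |a b. True})"
    unfolding left_range product_span_def left_generators times_mult_of .
qed

lemma E_right_span: "mult_right E x \<in> cspan {mult_right (D a) b |a b. True}"
proof (rule mult_of_span[OF nd])
  have "mult_of x * E \<in> (\<lambda>x. x * E) ` range mult_of" by simp
  then show "mult_of (mult_right E x) \<in> cspan (mult_of ` {mult_right (D a) b |a b. True})"
    unfolding right_range product_span_def right_generators mult_of_times .
qed

text \<open>Each D(a) x lies in E B, on which the idempotent E acts as the identity.\<close>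

lemma E_D: "E * D a = D a"
proof (rule multiplier_eqI_left[OF nd])
  fix x
  have "D a * mult_of x \<in> (*) E ` range mult_of"
    unfolding left_range product_span_def by (rule complex_vector.span_base) blast
  then obtain y where "D a * mult_of x = E * mult_of y" by blast
  then have "mult_left (D a) x = mult_left E y"
    unfolding times_mult_of by (rule mult_of_inj[OF nd])
  then show "mult_left (E * D a) x = mult_left (D a) x"
    by (metis idem mult_left_simps(6))
qed

lemma D_E: "D a * E = D a"
proof -
  have R: "mult_right (D a * E) x = mult_right (D a) x" for x
  proof -
    have "mult_of x * D a \<in> (\<lambda>x. x * E) ` range mult_of"
      unfolding right_range product_span_def by (rule complex_vector.span_base) blast
    then obtain y where "mult_of x * D a = mult_of y * E" by blast
    then have "mult_right (D a) x = mult_right E y"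
      unfolding mult_of_times by (rule mult_of_inj[OF nd])
    then show ?thesis by (metis idem mult_right_simps(6))
  qed
  \<comment> \<open>The equality \<open>R\<close> concerns right actions; multiplying by a test
    element on the left and using balance carries it to left actions.\<close>
  show ?thesis
    by (rule multiplier_eqI_left[OF nd], rule nondegenerate_eqI_left[OF nd])
      (simp only: times_mult_left R)
qed

text \<open>Says that z is the value of the extension at m, applied to x. It is a relation, so that
  values can be built from a non-unique expansion of E x before uniqueness is invoked. The mirror
  image \<open>right_action\<close> describes w as x times that value: w E = w and w D(c) = x D(m
  c).\<close>

definition left_action :: "'a multiplier \<Rightarrow> 'b \<Rightarrow> 'b \<Rightarrow> bool" where
  "left_action m x z \<longleftrightarrow>
     mult_left E z = z \<and> (\<forall>c. mult_left (D c) z = mult_left (D (mult_right m c)) x)"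

definition right_action :: "'a multiplier \<Rightarrow> 'b \<Rightarrow> 'b \<Rightarrow> bool" where
  "right_action m x w \<longleftrightarrow>
     mult_right E w = w \<and> (\<forall>c. mult_right (D c) w = mult_right (D (mult_left m c)) x)"

text \<open>As z = E z, the product y z equals (y E) z. Here y E is a sum of terms b D(a), and b
  D(a) z = b D(a m) x does not involve z.\<close>

lemma left_action_unique:
  assumes "left_action m x z" "left_action m x z'"
  shows "z = z'"
proof (rule nondegenerate_eqI_left[OF nd])
  fix y
  have "u * z = u * z'" if "u \<in> cspan {mult_right (D a) b |a b. True}" for u
    using that
  proof (induction rule: complex_vector.span_induct_alt)
    case (step c u v)
    then show ?case
      using assms
      by (auto simp: left_action_def algebra_bilinear_simps times_mult_left[symmetric])
  qed simp
  from this[OF E_right_span] have "mult_right E y * z = mult_right E y * z'" .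
  then show "y * z = y * z'"
    using assms by (simp add: left_action_def times_mult_left[symmetric])
qed

text \<open>Because D(c) E = D(c), only E x enters the equations, so x may be replaced by a sum of
  terms D(a) b.\<close>

lemma left_action_E: "left_action m (mult_left E x) z \<longleftrightarrow> left_action m x z"
  unfolding left_action_def mult_left_simps(6)[symmetric] D_E ..

lemma right_action_E: "right_action m (mult_right E x) z \<longleftrightarrow> right_action m x z"
  unfolding right_action_def mult_right_simps(6)[symmetric] E_D ..

text \<open>The second conjunct is the balance identity from which a multiplier is later assembled.
  It is carried through the same induction, against all right actions at once.\<close>

lemma left_action_exists:
  "\<exists>z. left_action m y z \<and> (\<forall>x w. right_action m x w \<longrightarrow> x * z = w * y)"
proof -
  have "\<exists>z. left_action m u z \<and> (\<forall>x w. right_action m x w \<longrightarrow> x * z = w * u)"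
    if "u \<in> cspan {mult_left (D a) b |a b. True}" for u
    using that
  proof (induction rule: complex_vector.span_induct_alt)
    case base
    show ?case by (rule exI[of _ 0]) (simp add: left_action_def mult_left_zero)
  next
    case (step c v u)
    then obtain a b z where v: "v = mult_left (D a) b" and z: "left_action m u z"
      and z': "\<And>x w. right_action m x w \<Longrightarrow> x * z = w * u" by blast
    \<comment> \<open>The multiplier m sends D(a) b to D(m a) b.\<close>
    let ?z = "c *\<^sub>C mult_left (D (mult_left m a)) b + z"
    have "mult_left E (mult_left (D (mult_left m a)) b) = mult_left (D (mult_left m a)) b"
      by (metis E_D mult_left_simps(6))
    \<comment> \<open>Both sides are D(d m a) b, since d (m a) = (d m) a.\<close>
    moreover have "mult_left (D d) (mult_left (D (mult_left m a)) b) =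
        mult_left (D (mult_right m d)) (mult_left (D a) b)" for d
      by (metis D_times mult_left_simps(6) times_mult_left)
    ultimately have "left_action m (c *\<^sub>C v + u) ?z"
      using z by (simp add: left_action_def mult_left_add mult_left_scaleC v)
    \<comment> \<open>On the new term, x D(m a) b = w D(a) b by the defining equation of w.\<close>
    moreover have "x * ?z = w * (c *\<^sub>C v + u)" if "right_action m x w" for x w
      using z'[OF that] that
      by (simp add: right_action_def algebra_bilinear_simps v times_mult_left)
    ultimately show ?case by blast
  qed
  from this[OF E_left_span, of y] obtain z where
    "left_action m y z" "\<forall>x w. right_action m x w \<longrightarrow> x * z = w * mult_left E y"
    unfolding left_action_E by blast
  then show ?thesis
    \<comment> \<open>The factor E disappears through w (E y) = (w E) y = w y.\<close>
    by (intro exI[of _ z]) (simp add: times_mult_left right_action_def)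
qed

text \<open>Mirror construction: m sends b D(a) to b D(a m), and b D(a m) D(d) = b D(a) D(m d).
  Balance with left actions is supplied by \<open>left_action_exists\<close>.\<close>

lemma right_action_exists: "\<exists>w. right_action m x w"
proof -
  have "\<exists>w. right_action m u w" if "u \<in> cspan {mult_right (D a) b |a b. True}" for u
    using that
  proof (induction rule: complex_vector.span_induct_alt)
    case base
    show ?case by (rule exI[of _ 0]) (simp add: right_action_def mult_right_zero)
  next
    case (step c v u)
    then obtain a b w where v: "v = mult_right (D a) b" and w: "right_action m u w" by blast
    have "mult_right E (mult_right (D (mult_right m a)) b) = mult_right (D (mult_right m a)) b"
      by (metis D_E mult_right_simps(6))
    moreover have "mult_right (D d) (mult_right (D (mult_right m a)) b) =
        mult_right (D (mult_left m d)) (mult_right (D a) b)" for d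
      by (metis D_times mult_right_simps(6) times_mult_left)
    ultimately have "right_action m (c *\<^sub>C v + u) (c *\<^sub>C mult_right (D (mult_right m a)) b + w)"
      using w by (simp add: right_action_def mult_right_add mult_right_scaleC v)
    then show ?case by blast
  qed
  from this[OF E_right_span] show ?thesis unfolding right_action_E .
qed

lemma multiplier_action_exists: "\<exists>M. \<forall>x. left_action m x (mult_left M x)"
proof -
  obtain R where R: "\<And>x. right_action m x (R x)" using right_action_exists by metis
  obtain L where L: "\<And>y. left_action m y (L y)"
    and "\<And>x y w. right_action m x w \<Longrightarrow> x * L y = w * y"
    using left_action_exists[of m] by metis
  then have "x * L y = R x * y" for x y using R by blast
  from multiplier_exI[OF nd this] show ?thesis using L by metis
qed

lemma extension_unique_exists:
  "\<exists>!F. algebra_hom F \<and> (\<forall>a. F (mult_of a) = D a) \<and> F 1 = E"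
proof -
  obtain F where F: "\<And>m x. left_action m x (mult_left (F m) x)"
    using multiplier_action_exists by metis
  \<comment> \<open>Any multiplier whose left action solves the two equations for m is
    \<open>F m\<close>; each identity below is a check of these equations.\<close>
  have eq: "F m = M" if "\<And>x. left_action m x (mult_left M x)" for m M
    using multiplier_eqI_left[OF nd] left_action_unique F that by metis
  have D: "D (x + y) = D x + D y" "D (c *\<^sub>C x) = c *\<^sub>C D x" for x y c
    using hom by (simp_all add: algebra_hom_def clinear_iff)
  note F' = F[unfolded left_action_def]
  have "F (m + n) = F m + F n" for m n
    by (rule eq) (use F' in \<open>simp add: left_action_def mult_left_add D\<close>)
  moreover have "F (c *\<^sub>C m) = c *\<^sub>C F m" for c m
    by (rule eq) (use F' in \<open>simp add: left_action_def mult_left_scaleC D\<close>)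
  \<comment> \<open>Applying the equations twice gives D(c) F(m) F(n) = D(c m) F(n) = D(c m
    n).\<close>
  moreover have "F (m * n) = F m * F n" for m n
    by (rule eq) (use F' in \<open>simp add: left_action_def\<close>)
  ultimately have "algebra_hom F"
    by (simp add: algebra_hom_def clinear_iff)
  moreover have "F (mult_of a) = D a" for a
    by (rule eq) (simp add: left_action_def D_times E_D flip: mult_left_simps(6))
  moreover have "F 1 = E"
    by (rule eq) (simp add: left_action_def D_E idem flip: mult_left_simps(6))
  \<comment> \<open>A competitor G solves the same equations: E G(m) = G(1) G(m) = G(m), and D(c)
    G(m) = G(c m) = D(c m) because c m lies in A.\<close>
  moreover have "G = F" if G: "algebra_hom G" "\<forall>a. G (mult_of a) = D a" "G 1 = E" for G
  proof
    fix m
    have mult: "G (m * n) = G m * G n" for m n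
      using G(1) by (simp add: algebra_hom_def)
    have "E * G m = G m"
      using mult[of 1 m] G(3) by simp
    moreover have "D c * G m = D (mult_right m c)" for c
      using mult[of "mult_of c" m] G(2) by (simp add: mult_of_times)
    ultimately show "G m = F m"
      by (intro eq[symmetric]) (simp add: left_action_def flip: mult_left_simps(6))
  qed
  ultimately show ?thesis by blast
qed

end

theorem propositionA2:
  fixes \<Delta> :: "'a::complex_algebra \<Rightarrow> ('a \<otimes> 'a) multiplier"
    and E :: "('a \<otimes> 'a) multiplier"
  assumes "nondegenerate TYPE('a)"
    and "idempotent_algebra TYPE('a)"
    and "coproduct \<Delta>"
    and "E * E = E"
    and "(*) E ` range mult_of = range \<Delta> \<odot> range mult_of"
    and "(\<lambda>x. x * E) ` range mult_of = range mult_of \<odot> range \<Delta>"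
  shows "\<exists>!\<Delta>\<^sub>1 :: 'a multiplier \<Rightarrow> ('a \<otimes> 'a) multiplier.
           algebra_hom \<Delta>\<^sub>1 \<and> (\<forall>a. \<Delta>\<^sub>1 (mult_of a) = \<Delta> a) \<and> \<Delta>\<^sub>1 1 = E"
proof -
  \<comment> \<open>The case B = A \<otimes> A, non-degenerate because A is.\<close>
  interpret hom_with_unit \<Delta> E
    using assms nondegenerate_tensor[OF assms(1) assms(1)]
    by unfold_locales (simp_all add: coproduct_def)
  show ?thesis by (rule extension_unique_exists)
qed

end
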